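(* Let $N,K\ge1$ and let $X_1,\ldots,X_K\in\mathbb{C}_{\le N-1}[z]$ be not all identically zero, with $\Gamma_{ij}(z)=X_i(z)\widetilde{X}_j(z)$. Let $Q=\gcd\{X_1,\ldots,X_K\}\in\mathbb{C}_{\le D}[z]$ and suppose that $H(z)=Q(z)\widetilde{Q}(z)\in\mathbb{C}_{\le 2D}[z]$ has $P$ (distinct) root pairs $(\delta_1,\overline{\delta}_1^{-1}),\ldots,(\delta_P,\overline{\delta}_P^{-1})$ outside the unit circle, with multiplicities $\mu_1,\ldots,\mu_P$, and (distinct) roots $\varepsilon_1,\ldots,\varepsilon_T\in\mathbb{T}$ with (even) multiplicities $\nu_1,\ldots,\nu_T$. Then the problem of finding $Y_1,\ldots,Y_K\in\mathbb{C}_{\le N-1}[z]$ with $\Gamma_{ij}(z)=Y_i(z)\widetilde{Y}_j(z)$ for all $i,j$ admits exactly $$\prod_{i=1}^{P}(\mu_i+1)$$ different solutions, where solutions $(Y_k)_k$ and $(Y'_k)_k$ are identified if $Y'_k=\beta Y_k$ for all $k$ with some $\beta\in\mathbb{T}$. In particular, when the roots of $H(z)$ are all simple and outside the unit circle, there are exactly $2^{D}$ different solutions.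
   Context: $\mathbb{T} = \{z\in\mathbb{C} : |z|=1\}$. $\mathbb{C}_{\le D}[z]$ is the $(D+1)$-dimensional space of complex univariate polynomials of degree at most $D$; a polynomial is always considered together with the space (degree bound) it belongs to. For $A(z)=\sum_{n=0}^{D} a[n]z^n \in \mathbb{C}_{\le D}[z]$, the conjugate reversal is $\widetilde{A}(z) = z^{D}\,\overline{A(\overline{z}^{-1})} = \sum_{n=0}^{D}\overline{a[D-n]}z^n \in \mathbb{C}_{\le D}[z]$. Multiplication is the map $\mathbb{C}_{\le D_1}[z]\times\mathbb{C}_{\le D_2}[z]\to\mathbb{C}_{\le D_1+D_2}[z]$. Roots: $A\in\mathbb{C}_{\le D}[z]\setminus\{0\}$ has a root at $\infty$ of multiplicity $\mu$ if exactly its $\mu$ leading coefficients $a[D],\ldots,a[D-\mu+1]$ vanish; roots are counted in $\mathbb{C}\cup\{\infty\}$, so that a nonzero $A\in\mathbb{C}_{\le D}[z]$ has exactly $D$ roots with multiplicity. Conventions: $0^{-1}=\infty$, $\infty^{-1}=0$, $\overline{\infty}=\infty$. Root pairs: if $\delta\in(\mathbb{C}\cup\{\infty\})\setminus\mathbb{T}$ is a root of $H=Q\widetilde Q$ with multiplicity $\mu$ then $\overline{\delta}^{-1}$ is also a root with the same multiplicity $\mu$, and the pair $(\delta,\overline{\delta}^{-1})$ is called a root pair of multiplicity $\mu$ (each pair is listed once). Roots of $H$ in $\mathbb{T}$ have even multiplicity. Divisibility: $C\in\mathbb{C}_{\le M}[z]$ has a divisor $B\in\mathbb{C}_{\le D}[z]\setminus\{0\}$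 if there is $A\in\mathbb{C}_{\le M-D}[z]$ with $C=AB$. The $\gcd$ of a set of polynomials (each in its own space) is the polynomial in $\mathbb{C}_{\le D}[z]$ with highest possible $D$ that divides all of them in this sense (with $\gcd\{A,0\}=A$), defined up to a nonzero scalar; here $Q$ is any fixed choice. *)

theory Defs
  imports Complex_Main "HOL-Library.FuncSet" "HOL-Computational_Algebra.Polynomial"
begin

text \<open>
  A polynomial belonging to the space of polynomials of degree at most \<open>D\<close> is represented by a
  \<^typ>\<open>complex poly\<close> together with the explicit bound \<open>D\<close>. The bound is not determined by the
  polynomial, and conjugate reversal, divisibility, gcd and roots at infinity all depend on it.
\<close>

definition polys_le :: "nat \<Rightarrow> complex poly set" where
  "polys_le D = {A. degree A \<le> D}"

definition unit_circle :: "complex set" where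
  "unit_circle = {z. cmod z = 1}"

definition conj_rev :: "nat \<Rightarrow> complex poly \<Rightarrow> complex poly" where
  "conj_rev D A = (\<Sum>n\<le>D. monom (cnj (coeff A (D - n))) n)"

datatype ext_complex = Fin complex | Infty

fun ext_cnj :: "ext_complex \<Rightarrow> ext_complex" where
  "ext_cnj (Fin z) = Fin (cnj z)"
| "ext_cnj Infty = Infty"

fun ext_inverse :: "ext_complex \<Rightarrow> ext_complex" where
  "ext_inverse (Fin z) = (if z = 0 then Infty else Fin (inverse z))"
| "ext_inverse Infty = Fin 0"

text \<open>
  Multiplicity of a point as a root of a nonzero \<open>A\<close> in the space with bound \<open>D\<close>, where 0 means
  that the point is not a root. At infinity it is the number of leading coefficients, counted
  from index \<open>D\<close> downwards, that vanish.
\<close>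

fun root_mult :: "nat \<Rightarrow> complex poly \<Rightarrow> ext_complex \<Rightarrow> nat" where
  "root_mult D A (Fin z) = order z A"
| "root_mult D A Infty = (LEAST m. coeff A (D - m) \<noteq> 0)"

definition is_root :: "nat \<Rightarrow> complex poly \<Rightarrow> ext_complex \<Rightarrow> bool" where
  "is_root D A x \<longleftrightarrow> root_mult D A x > 0"

definition has_divisor :: "nat \<Rightarrow> complex poly \<Rightarrow> nat \<Rightarrow> complex poly \<Rightarrow> bool" where
  "has_divisor M C D B \<longleftrightarrow>
     B \<in> polys_le D \<and> B \<noteq> 0 \<and> D \<le> M \<and> (\<exists>A\<in>polys_le (M - D). C = A * B)"

text \<open>
  A set of polynomials, each in its own space, is a set of pairs (bound, polynomial). The gcd is
  only determined up to a nonzero scalar, so it is a relation. Maximality concerns the bound of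
  the space, not the degree, so that common roots at infinity are included.
\<close>

definition common_divisor :: "(nat \<times> complex poly) set \<Rightarrow> nat \<Rightarrow> complex poly \<Rightarrow> bool" where
  "common_divisor F D B \<longleftrightarrow> (\<forall>(M, C)\<in>F. has_divisor M C D B)"

definition is_gcd :: "(nat \<times> complex poly) set \<Rightarrow> nat \<Rightarrow> complex poly \<Rightarrow> bool" where
  "is_gcd F D Q \<longleftrightarrow> common_divisor F D Q \<and> (\<forall>D' B. common_divisor F D' B \<longrightarrow> D' \<le> D)"

text \<open>
  The \<open>K\<close>-tuples are the extensional functions on \<open>{1..K}\<close>, so that distinct elements of the
  following set are distinct tuples.
\<close>

definition solutions ::
    "nat \<Rightarrow> nat \<Rightarrow> (nat \<Rightarrow> nat \<Rightarrow> complex poly) \<Rightarrow> (nat \<Rightarrow> complex poly) set" where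
  "solutions N K \<Gamma> =
     {Y \<in> {1..K} \<rightarrow>\<^sub>E polys_le (N - 1).
        \<forall>i\<in>{1..K}. \<forall>j\<in>{1..K}. \<Gamma> i j = Y i * conj_rev (N - 1) (Y j)}"

definition phase_equiv ::
    "nat \<Rightarrow> nat \<Rightarrow> (nat \<Rightarrow> nat \<Rightarrow> complex poly)
      \<Rightarrow> ((nat \<Rightarrow> complex poly) \<times> (nat \<Rightarrow> complex poly)) set" where
  "phase_equiv N K \<Gamma> =
     {(Y, Y') \<in> solutions N K \<Gamma> \<times> solutions N K \<Gamma>.
        \<exists>\<beta>\<in>unit_circle. \<forall>k\<in>{1..K}. Y' k = smult \<beta> (Y k)}"

end

theory Submission
  imports Defs "HOL-Computational_Algebra.Fundamental_Theorem_Algebra"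
begin

text \<open>
  Dividing the \<open>X\<^sub>k\<close> by their gcd gives \<open>X\<^sub>k = R\<^sub>k Q\<close>, where the cofactors \<open>R\<^sub>k\<close> have no common root
  on the extended plane, because such a root could be moved into \<open>Q\<close>, in a larger space. For a
  solution \<open>Y\<close>, the equations \<open>Y\<^sub>i conj_rev Y\<^sub>j = X\<^sub>i conj_rev X\<^sub>j\<close> make the tuple \<open>Y\<close> proportional to
  the tuple \<open>R\<close> as vectors of rational functions. Since the \<open>R\<^sub>k\<close> have no common root, the
  proportionality factor is a polynomial \<open>Q'\<close>; since one of them has full degree, \<open>Q'\<close> belongs to
  the space of \<open>Q\<close>. Cancelling the \<open>R\<^sub>k\<close> leaves \<open>Q' conj_rev Q' = Q conj_rev Q = H\<close>. So the
  solutions are exactly the tuples \<open>(R\<^sub>k Q')\<^sub>k\<close> with \<open>Q'\<close> a spectral factor of \<open>H\<close>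
  (\<open>solutions_eq_multiples_of_spectral_factors\<close>), and it remains to count the spectral factors up
  to a unimodular constant.

  Conjugate reversal reflects roots in the unit circle, infinity included. The multiplicities in a
  spectral factor at a point and at its mirror image therefore add up to the multiplicity in \<open>H\<close>.
  On the circle this forces the multiplicity; for a root pair off the circle the only freedom is
  how the multiplicity \<open>\<mu>\<close> in \<open>H\<close> is split between the two points. Two spectral factors with the
  same split differ by a constant, which has modulus 1 because both have the same product with
  their reversal (\<open>profile_determines_factor\<close>). Every split occurs: replacing one linear factor of
  a spectral factor by its conjugate reversal gives a spectral factor again and moves one root to
  its mirror image (\<open>spectral_factor_move_root\<close>). Each pair contributes \<open>\<mu> + 1\<close> choices.

  If all roots of \<open>H\<close> are simple and off the circle, each pair contributes exactly one of the \<open>D\<close>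
  roots of \<open>Q\<close>, so there are \<open>D\<close> pairs with two choices each.
\<close>

section \<open>Conjugate reversal\<close>

lemma coeff_conj_rev: "coeff (conj_rev D A) n = (if n \<le> D then cnj (coeff A (D - n)) else 0)"
proof -
  have "coeff (conj_rev D A) n = (\<Sum>k\<le>D. if k = n then cnj (coeff A (D - k)) else 0)"
    unfolding conj_rev_def coeff_sum by (intro sum.cong) (auto simp: coeff_monom)
  then show ?thesis by simp
qed

lemma mult_in_polys_le: "A \<in> polys_le D \<Longrightarrow> B \<in> polys_le E \<Longrightarrow> A * B \<in> polys_le (D + E)"
  using degree_mult_le[of A B] by (simp add: polys_le_def)

lemma conj_rev_in_polys_le: "conj_rev D A \<in> polys_le D"
  unfolding polys_le_def by (auto intro!: degree_le simp: coeff_conj_rev)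

lemma conj_rev_conj_rev: "A \<in> polys_le D \<Longrightarrow> conj_rev D (conj_rev D A) = A"
  unfolding polys_le_def by (auto intro!: poly_eqI simp: coeff_conj_rev coeff_eq_0)

lemma conj_rev_0 [simp]: "conj_rev D 0 = 0"
  by (intro poly_eqI) (simp add: coeff_conj_rev)

lemma conj_rev_smult: "conj_rev D (smult c A) = smult (cnj c) (conj_rev D A)"
  by (intro poly_eqI) (simp add: coeff_conj_rev)

lemma conj_rev_eq_0_iff: "A \<in> polys_le D \<Longrightarrow> conj_rev D A = 0 \<longleftrightarrow> A = 0"
  using conj_rev_conj_rev[of A D] by auto

text \<open>
  The library operation \<^const>\<open>reflect_poly\<close> reverses with respect to the actual degree. The power of
  the variable makes up for the difference to the bound of the space; multiplicativity of the
  reversal then reduces to that of reflection and of conjugation.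
\<close>

lemma conj_rev_eq_reflect_poly:
  assumes "A \<in> polys_le D"
  shows "conj_rev D A = monom 1 (D - degree A) * reflect_poly (map_poly cnj A)"
proof (rule poly_eqI)
  fix n
  have "degree A \<le> D" using assms by (simp add: polys_le_def)
  moreover have "degree (map_poly cnj A) = degree A" by (rule degree_map_poly) simp
  moreover have "degree A < D - n" if "n < D - degree A" using that by linarith
  ultimately show "coeff (conj_rev D A) n =
      coeff (monom 1 (D - degree A) * reflect_poly (map_poly cnj A)) n"
    by (auto simp: coeff_conj_rev coeff_monom_mult coeff_reflect_poly coeff_map_poly coeff_eq_0)
qed

lemma map_poly_cnj_mult: "map_poly cnj (A * B) = map_poly cnj A * map_poly cnj B"
  by (rule poly_eq_poly_eq_iff[THEN iffD1]) (simp add: fun_eq_iff)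

lemma conj_rev_mult:
  assumes "A \<in> polys_le D" "B \<in> polys_le E"
  shows "conj_rev (D + E) (A * B) = conj_rev D A * conj_rev E B"
proof (cases "A = 0 \<or> B = 0")
  case False
  have le: "degree A \<le> D" "degree B \<le> E" using assms by (auto simp: polys_le_def)
  then have "A * B \<in> polys_le (D + E)"
    using degree_mult_le[of A B] by (simp add: polys_le_def)
  moreover have "D + E - degree (A * B) = (D - degree A) + (E - degree B)"
    using False le by (simp add: degree_mult_eq)
  ultimately show ?thesis
    using mult_monom[of "1::complex" "D - degree A" 1 "E - degree B"]
    by (simp add: conj_rev_eq_reflect_poly assms map_poly_cnj_mult reflect_poly_mult mult_ac)
qed auto

section \<open>Root multiplicities on the extended plane\<close>

text \<open>
  Reflection in the unit circle, which exchanges 0 and infinity.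
\<close>

abbreviation mirror :: "ext_complex \<Rightarrow> ext_complex" where
  "mirror x \<equiv> ext_inverse (ext_cnj x)"

lemma mirror_mirror: "mirror (mirror x) = x"
  by (cases x) auto

lemma mult_cnj_eq_1_iff: "z * cnj z = 1 \<longleftrightarrow> z \<in> unit_circle"
proof -
  have "z * cnj z = 1 \<longleftrightarrow> complex_of_real ((cmod z)\<^sup>2) = of_real 1"
    by (simp only: complex_norm_square of_real_1)
  also have "\<dots> \<longleftrightarrow> z \<in> unit_circle"
    unfolding of_real_eq_iff by (simp add: unit_circle_def power2_eq_1_iff)
      (use norm_ge_zero[of z] in linarith)
  finally show ?thesis .
qed

lemma mirror_fixed_iff: "mirror x = x \<longleftrightarrow> x \<in> Fin ` unit_circle"
proof (cases x)
  case (Fin z)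
  have "inverse (cnj z) = z \<longleftrightarrow> z * cnj z = 1" if "z \<noteq> 0"
    using that by (auto simp: field_simps)
  then show ?thesis using Fin by (auto simp: mult_cnj_eq_1_iff unit_circle_def)
qed auto

lemma root_mult_Infty:
  assumes "A \<in> polys_le D" "A \<noteq> 0"
  shows "root_mult D A Infty = D - degree A"
  unfolding root_mult.simps
proof (rule Least_equality)
  show "coeff A (D - (D - degree A)) \<noteq> 0" using assms by (simp add: polys_le_def)
  fix m assume "coeff A (D - m) \<noteq> 0"
  then show "D - degree A \<le> m" using le_degree[of A "D - m"] by linarith
qed

lemma root_mult_mult:
  assumes "A \<in> polys_le D" "B \<in> polys_le E" "A \<noteq> 0" "B \<noteq> 0"
  shows "root_mult (D + E) (A * B) x = root_mult D A x + root_mult E B x"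
proof (cases x)
  case (Fin z)
  then show ?thesis using assms by (simp add: order_mult)
next
  case Infty
  have le: "degree A \<le> D" "degree B \<le> E" using assms by (auto simp: polys_le_def)
  then have "A * B \<in> polys_le (D + E)"
    using degree_mult_le[of A B] by (simp add: polys_le_def)
  then have "root_mult (D + E) (A * B) Infty = D + E - (degree A + degree B)"
    using assms by (subst root_mult_Infty) (auto simp: degree_mult_eq)
  then show ?thesis
    using le root_mult_Infty[OF assms(1,3)] root_mult_Infty[OF assms(2,4)] Infty by simp
qed

text \<open>
  The polynomial whose only root in the space of degree bound 1 is the given point. With the
  constant 1 as the factor at infinity, finite and infinite roots are split off in the same way.
\<close>

fun root_factor :: "ext_complex \<Rightarrow> complex poly" where
  "root_factor (Fin a) = [:- a, 1:]"
| "root_factor Infty = 1"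

lemma root_factor_in_polys_le: "root_factor x \<in> polys_le 1"
  by (cases x) (auto simp: polys_le_def)

lemma root_factor_nonzero: "root_factor x \<noteq> 0"
  by (cases x) auto

lemma root_mult_root_factor: "root_mult 1 (root_factor x) y = (if x = y then 1 else 0)"
proof (cases y)
  case (Fin b)
  show ?thesis
  proof (cases x)
    fix a assume "x = Fin a"
    then show ?thesis using Fin order_power_n_n[of a 1] by (auto intro!: order_0I)
  qed (simp add: Fin)
next
  case Infty
  have "degree (root_factor x) = (if x = Infty then 0 else 1)" by (cases x) auto
  then show ?thesis
    using root_mult_Infty[OF root_factor_in_polys_le root_factor_nonzero, of x] Infty
    by (simp only: Infty) auto
qed

lemma root_factorE:
  assumes "A \<in> polys_le D" "A \<noteq> 0" "root_mult D A x > 0"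
  obtains E B where "D = 1 + E" "B \<in> polys_le E" "B \<noteq> 0" "A = root_factor x * B"
proof (cases x)
  case (Fin a)
  then have "[:- a, 1:] dvd A"
    using assms by (simp add: order_gt_0_iff poly_eq_0_iff_dvd)
  then obtain B where B: "A = [:- a, 1:] * B" by blast
  then have "B \<noteq> 0" using assms by auto
  then have "degree A = Suc (degree B)" unfolding B by (subst degree_mult_eq) auto
  then show ?thesis using that[of "D - 1" B] assms B Fin \<open>B \<noteq> 0\<close> by (auto simp: polys_le_def)
next
  case Infty
  then have "degree A < D" using assms root_mult_Infty[of A D] by auto
  then show ?thesis using that[of "D - 1" A] assms Infty by (auto simp: polys_le_def)
qed

lemma root_mult_conj_rev_root_factor: "root_mult 1 (conj_rev 1 (root_factor x)) (mirror x) > 0"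
proof -
  let ?R = "conj_rev 1 (root_factor x)"
  have R: "?R \<in> polys_le 1" "?R \<noteq> 0"
    using conj_rev_in_polys_le conj_rev_eq_0_iff[OF root_factor_in_polys_le] root_factor_nonzero
    by auto
  show ?thesis
  proof (cases x)
    case Infty
    have "poly ?R 0 = 0" using Infty by (simp add: poly_0_coeff_0 coeff_conj_rev)
    then show ?thesis using Infty R by (simp add: order_gt_0_iff)
  next
    case (Fin a)
    have eq: "?R = [:1, - cnj a:]"
      using Fin by (intro poly_eqI) (auto simp: coeff_conj_rev coeff_pCons split: nat.splits)
    show ?thesis
    proof (cases "a = 0")
      case True
      then show ?thesis using root_mult_Infty[OF R] Fin eq by simp
    next
      case False
      then show ?thesis using Fin eq by (simp add: order_gt_0_iff)
    qed
  qed
qed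

text \<open>
  Each root of \<open>A\<close> that is split off contributes a root of the reversal at the mirror image, so
  induction on the degree bound gives one inequality. Since reversal and reflection are
  involutions, the other inequality is the same statement for the reversal of \<open>A\<close>.
\<close>

lemma root_mult_le_conj_rev:
  assumes "A \<in> polys_le D" "A \<noteq> 0"
  shows "root_mult D A x \<le> root_mult D (conj_rev D A) (mirror x)"
  using assms
proof (induction D arbitrary: A rule: less_induct)
  case (less D)
  show ?case
  proof (cases "root_mult D A x > 0")
    case True
    then obtain E B where EB: "D = 1 + E" "B \<in> polys_le E" "B \<noteq> 0" "A = root_factor x * B"
      using root_factorE less.prems by blast
    have "root_mult D A x = 1 + root_mult E B x"
      using EB root_mult_mult[OF root_factor_in_polys_le EB(2) root_factor_nonzero EB(3), of x x]
      by (simp add: root_mult_root_factor del: One_nat_def)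
    also have "\<dots> \<le> root_mult 1 (conj_rev 1 (root_factor x)) (mirror x) +
        root_mult E (conj_rev E B) (mirror x)"
      using root_mult_conj_rev_root_factor[of x] less.IH[of E B] EB by simp
    also have "\<dots> = root_mult D (conj_rev D A) (mirror x)"
      using EB root_factor_in_polys_le root_factor_nonzero
      by (simp only: EB conj_rev_mult root_mult_mult conj_rev_in_polys_le conj_rev_eq_0_iff not_False_eq_True)
    finally show ?thesis .
  qed simp
qed

lemma root_mult_conj_rev:
  assumes "A \<in> polys_le D" "A \<noteq> 0"
  shows "root_mult D (conj_rev D A) x = root_mult D A (mirror x)"
proof (rule antisym)
  show "root_mult D (conj_rev D A) x \<le> root_mult D A (mirror x)"
    using root_mult_le_conj_rev[of "conj_rev D A" D x] assms
    by (simp add: conj_rev_in_polys_le conj_rev_eq_0_iff conj_rev_conj_rev)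
  show "root_mult D A (mirror x) \<le> root_mult D (conj_rev D A) x"
    using root_mult_le_conj_rev[OF assms, of "mirror x"] by (simp add: mirror_mirror)
qed

text \<open>
  A complex polynomial is, up to a constant, the product of its linear factors, so inclusion of the
  multisets of roots gives divisibility.
\<close>

lemma dvd_if_order_le:
  fixes p q :: "complex poly"
  assumes "p \<noteq> 0" "q \<noteq> 0" "\<And>z. order z p \<le> order z q"
  shows "p dvd q"
proof -
  let ?lin = "\<lambda>z::complex. [:- z, 1:]"
  have "proots p \<subseteq># proots q" using assms by (intro mset_subset_eqI) simp
  then have "(\<Prod>z\<in>#proots p. ?lin z) dvd (\<Prod>z\<in>#proots q. ?lin z)"
    by (intro prod_mset_subset_imp_dvd image_mset_subseteq_mono)
  then have "smult (lead_coeff p) (\<Prod>z\<in>#proots p. ?lin z) dvd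
      smult (lead_coeff q) (\<Prod>z\<in>#proots q. ?lin z)"
    using assms by (simp add: smult_dvd_iff dvd_smult)
  then show ?thesis by (simp only: complex_poly_decompose_multiset)
qed

lemma eq_smult_if_order_eq:
  fixes p q :: "complex poly"
  assumes "p \<noteq> 0" "q \<noteq> 0" "\<And>z. order z p = order z q"
  obtains c where "c \<noteq> 0" "q = smult c p"
proof -
  obtain r where r: "q = p * r" using dvd_if_order_le[of p q] assms by (auto elim: dvdE)
  have "degree q \<le> degree p" 
    using dvd_if_order_le[of q p] assms by (intro dvd_imp_degree_le) auto
  then have "degree r = 0" using r assms by (auto simp: degree_mult_eq)
  then obtain c where "r = [:c:]" by (rule degree_eq_zeroE)
  then show ?thesis using that[of c] r assms by auto
qed

text \<open>
  Counted with multiplicity, a nonzero polynomial has as many roots on the extended plane as its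
  degree bound says. They can be split off one by one, because a polynomial without finite roots
  is constant and then vanishes at infinity as long as the bound is positive.
\<close>

lemma card_roots_if_simple:
  assumes "A \<in> polys_le D" "A \<noteq> 0" "\<And>x. root_mult D A x \<le> 1"
  shows "finite {x. root_mult D A x > 0} \<and> card {x. root_mult D A x > 0} = D"
  using assms
proof (induction D arbitrary: A)
  case 0
  then obtain c where c: "A = [:c:]" "c \<noteq> 0" 
    by (auto simp: polys_le_def elim: degree_eq_zeroE)
  have "root_mult 0 A x = 0" for x
    using 0 c root_mult_Infty[of A 0] by (cases x) (auto intro!: order_0I)
  then show ?case by simp
next
  case (Suc D)
  have "\<exists>x. root_mult (Suc D) A x > 0"
  proof (cases "degree A = 0")
    case True
    then show ?thesis using root_mult_Infty[of A "Suc D"] Suc.prems by (intro exI[of _ Infty]) auto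
  next
    case False
    then obtain z where "poly A z = 0"
      using fundamental_theorem_of_algebra[of A] by (auto simp: constant_degree)
    then show ?thesis using Suc.prems by (intro exI[of _ "Fin z"]) (simp add: order_gt_0_iff)
  qed
  then obtain x where x: "root_mult (Suc D) A x > 0" ..
  then obtain B where B: "B \<in> polys_le D" "B \<noteq> 0" "A = root_factor x * B"
    using root_factorE[OF Suc.prems(1,2) x] by (metis Suc_eq_plus1_left Suc_inject)
  have m: "root_mult (Suc D) A y = (if x = y then 1 else 0) + root_mult D B y" for y
    using root_mult_mult[OF root_factor_in_polys_le B(1) root_factor_nonzero B(2), of x y]
    by (simp add: B(3) root_mult_root_factor plus_1_eq_Suc del: One_nat_def)
  have le: "root_mult D B y \<le> 1" for y using Suc.prems(3)[of y] m[of y] by simp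
  have "root_mult D B x = 0" using Suc.prems(3)[of x] m[of x] by simp
  moreover have "{y. root_mult (Suc D) A y > 0} = insert x {y. root_mult D B y > 0}"
    by (auto simp: m split: if_splits)
  ultimately show ?case using Suc.IH[OF B(1,2) le] by simp
qed

section \<open>Spectral factors\<close>

text \<open>
  The name is that of signal processing: on the unit circle, \<open>H\<close> is \<open>z ^ D\<close> times the spectrum
  \<open>\<bar>Q z\<bar>\<^sup>2\<close>.
\<close>

definition spectral_factors :: "nat \<Rightarrow> complex poly \<Rightarrow> complex poly set" where
  "spectral_factors D H = {Q \<in> polys_le D. Q * conj_rev D Q = H}"

lemma root_mult_spectral_factor:
  assumes "Q \<in> spectral_factors D H" "H \<noteq> 0"
  shows "root_mult (2 * D) H x = root_mult D Q x + root_mult D Q (mirror x)"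
proof -
  have Q: "Q \<in> polys_le D" "Q \<noteq> 0" "H = Q * conj_rev D Q"
    using assms by (auto simp: spectral_factors_def)
  then show ?thesis
    using root_mult_mult[of Q D "conj_rev D Q" D x]
    by (simp add: conj_rev_in_polys_le conj_rev_eq_0_iff root_mult_conj_rev mult_2)
qed

lemma spectral_factor_smult_iff:
  assumes "Q \<in> spectral_factors D H" "H \<noteq> 0"
  shows "smult c Q \<in> spectral_factors D H \<longleftrightarrow> c \<in> unit_circle"
proof -
  have Q: "Q \<in> polys_le D" "H = Q * conj_rev D Q" using assms by (auto simp: spectral_factors_def)
  have "smult c Q \<in> spectral_factors D H \<longleftrightarrow> smult (c * cnj c - 1) H = 0"
    using Q degree_smult_le[of c Q]
    by (auto simp: spectral_factors_def polys_le_def conj_rev_smult smult_diff_left mult_ac)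
  also have "\<dots> \<longleftrightarrow> c * cnj c = 1" using assms(2) by simp
  also have "\<dots> \<longleftrightarrow> c \<in> unit_circle"
    by (rule mult_cnj_eq_1_iff)
  finally show ?thesis .
qed

text \<open>
  Write \<open>Q = L B\<close> with \<open>L\<close> the factor belonging to \<open>x\<close>. Exchanging \<open>L\<close> for its conjugate reversal only
  swaps the two factors \<open>L\<close> and \<open>conj_rev L\<close> in \<open>Q conj_rev Q\<close>, but moves one root from \<open>x\<close> to its
  mirror image.
\<close>

lemma spectral_factor_move_root:
  assumes Q: "Q \<in> spectral_factors D H" and "H \<noteq> 0"
    and x: "x \<noteq> mirror x" and root: "root_mult D Q x > 0"
  obtains Q' where "Q' \<in> spectral_factors D H"
    "root_mult D Q x = root_mult D Q' x + 1"
    "root_mult D Q' (mirror x) = root_mult D Q (mirror x) + 1"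
    "\<And>y. y \<noteq> x \<Longrightarrow> y \<noteq> mirror x \<Longrightarrow> root_mult D Q' y = root_mult D Q y"
proof -
  let ?L = "root_factor x"
  note L = root_factor_in_polys_le[of x] root_factor_nonzero[of x]
  have "Q \<in> polys_le D" "Q \<noteq> 0" using assms by (auto simp: spectral_factors_def)
  then obtain E B where EB: "D = 1 + E" "B \<in> polys_le E" "B \<noteq> 0" "Q = ?L * B"
    using root_factorE[OF _ _ root] by blast
  have L': "conj_rev 1 ?L \<in> polys_le 1" "conj_rev 1 ?L \<noteq> 0"
    using conj_rev_in_polys_le conj_rev_eq_0_iff[OF L(1)] L(2) by auto
  define Q' where "Q' = conj_rev 1 ?L * B"
  have "conj_rev D Q' = ?L * conj_rev E B"
    unfolding Q'_def EB(1) using conj_rev_mult[OF L'(1) EB(2)] conj_rev_conj_rev[OF L(1)] by simp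
  moreover have "conj_rev D Q = conj_rev 1 ?L * conj_rev E B"
    unfolding EB(1,4) using conj_rev_mult[OF L(1) EB(2)] by simp
  ultimately have "Q' * conj_rev D Q' = Q * conj_rev D Q"
    using EB(4) by (simp add: Q'_def mult_ac)
  moreover have "Q' \<in> polys_le D"
    using degree_mult_le[of "conj_rev 1 ?L" B] L'(1) EB(1,2) by (simp add: Q'_def polys_le_def)
  ultimately have Q': "Q' \<in> spectral_factors D H" using Q by (simp add: spectral_factors_def)
  have m: "root_mult D Q y = (if x = y then 1 else 0) + root_mult E B y"
    "root_mult D Q' y = (if x = mirror y then 1 else 0) + root_mult E B y" for y
    unfolding EB(1,4) Q'_def
    using root_mult_mult[OF L(1) EB(2) L(2) EB(3), of y]
      root_mult_mult[OF L'(1) EB(2) L'(2) EB(3), of y]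
      root_mult_conj_rev[OF L, of y]
    by (simp_all add: root_mult_root_factor del: One_nat_def)
  show ?thesis
  proof (rule that[OF Q'])
    show "root_mult D Q x = root_mult D Q' x + 1"
      and "root_mult D Q' (mirror x) = root_mult D Q (mirror x) + 1"
      using x by (simp_all add: m mirror_mirror)
    show "root_mult D Q' y = root_mult D Q y" if "y \<noteq> x" "y \<noteq> mirror x" for y
    proof -
      have "x \<noteq> mirror y" using that mirror_mirror[of y] by metis
      then show ?thesis using that by (simp add: m)
    qed
  qed
qed

text \<open>
  Moving roots one at a time, in the direction of the deviation from \<open>n\<close>. If the multiplicity at
  \<open>x\<close> is below \<open>n\<close>, there is a root at the mirror image to move because the two multiplicities add
  up to the one in \<open>H\<close>, which is at least \<open>n\<close>.
\<close>

lemma spectral_factor_set_mult: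
  assumes Q: "Q \<in> spectral_factors D H" and H: "H \<noteq> 0"
    and x: "x \<noteq> mirror x" and n: "n \<le> root_mult (2 * D) H x"
  shows "\<exists>Q'\<in>spectral_factors D H. root_mult D Q' x = n \<and>
    (\<forall>y. y \<noteq> x \<longrightarrow> y \<noteq> mirror x \<longrightarrow> root_mult D Q' y = root_mult D Q y)"
  using Q
proof (induction "nat \<bar>int (root_mult D Q x) - int n\<bar>" arbitrary: Q rule: less_induct)
  case less
  consider "root_mult D Q x = n" | "root_mult D Q x > n" | "root_mult D Q x < n" by linarith
  then show ?case
  proof cases
    case 1
    then show ?thesis using less.prems by blast
  next
    case 2
    then have "root_mult D Q x > 0" by simp
    then obtain Q' where Q': "Q' \<in> spectral_factors D H"
      "root_mult D Q x = root_mult D Q' x + 1"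
      "\<And>y. y \<noteq> x \<Longrightarrow> y \<noteq> mirror x \<Longrightarrow> root_mult D Q' y = root_mult D Q y"
      using spectral_factor_move_root[OF less.prems H x] by blast
    have "nat \<bar>int (root_mult D Q' x) - int n\<bar> < nat \<bar>int (root_mult D Q x) - int n\<bar>"
      using 2 Q'(2) by linarith
    from less.hyps[OF this Q'(1)] show ?thesis by (simp add: Q'(3) cong: imp_cong)
  next
    case 3
    then have pos: "root_mult D Q (mirror x) > 0"
      using n root_mult_spectral_factor[OF less.prems H, of x] by linarith
    obtain Q' where Q': "Q' \<in> spectral_factors D H"
      "root_mult D Q' x = root_mult D Q x + 1"
      "\<And>y. y \<noteq> x \<Longrightarrow> y \<noteq> mirror x \<Longrightarrow> root_mult D Q' y = root_mult D Q y"
      using spectral_factor_move_root[OF less.prems H _ pos, unfolded mirror_mirror] x by metis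
    have "nat \<bar>int (root_mult D Q' x) - int n\<bar> < nat \<bar>int (root_mult D Q x) - int n\<bar>"
      using 3 Q'(2) by linarith
    from less.hyps[OF this Q'(1)] show ?thesis by (simp add: Q'(3) cong: imp_cong)
  qed
qed


text \<open>
  One representative \<open>\<delta> i\<close> is chosen from each root pair of \<open>H\<close> off the unit circle. The multiplicities
  of a spectral factor at these representatives (its profile) record how the roots of \<open>H\<close> are
  distributed between the factor and its reversal.
\<close>

locale root_pairs =
  fixes D P :: nat and H :: "complex poly" and \<delta> :: "nat \<Rightarrow> ext_complex"
  assumes H_nonzero: "H \<noteq> 0"
    and pair_root: "i \<in> {1..P} \<Longrightarrow> is_root (2 * D) H (\<delta> i)"
    and pair_off_circle: "i \<in> {1..P} \<Longrightarrow> \<delta> i \<notin> Fin ` unit_circle"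
    and pairs_distinct: "i \<in> {1..P} \<Longrightarrow> j \<in> {1..P} \<Longrightarrow> i \<noteq> j \<Longrightarrow>
      \<delta> i \<noteq> \<delta> j \<and> \<delta> i \<noteq> mirror (\<delta> j)"
    and pairs_exhaustive: "is_root (2 * D) H x \<Longrightarrow> x \<notin> Fin ` unit_circle \<Longrightarrow>
      \<exists>i\<in>{1..P}. x = \<delta> i \<or> x = mirror (\<delta> i)"
begin

definition profile :: "complex poly \<Rightarrow> nat \<Rightarrow> nat" where
  "profile Q = (\<lambda>i\<in>{1..P}. root_mult D Q (\<delta> i))"

text \<open>
  The profile fixes the multiplicities at all points: at a mirror image by complement, and on the
  circle because there the multiplicity is half of that in \<open>H\<close>. Polynomials with equal
  multiplicities at all finite points are proportional.
\<close>

lemma profile_determines_factor: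
  assumes Q: "Q \<in> spectral_factors D H" and Q': "Q' \<in> spectral_factors D H"
    and eq: "profile Q = profile Q'"
  obtains \<beta> where "\<beta> \<in> unit_circle" "Q' = smult \<beta> Q"
proof -
  note mQ = root_mult_spectral_factor[OF Q H_nonzero]
  note mQ' = root_mult_spectral_factor[OF Q' H_nonzero]
  have pair: "root_mult D Q (\<delta> i) = root_mult D Q' (\<delta> i)" if "i \<in> {1..P}" for i
    using fun_cong[OF eq, of i] that by (simp add: profile_def)
  have same: "root_mult D Q x = root_mult D Q' x" for x
  proof -
    consider "\<not> is_root (2 * D) H x" | "x \<in> Fin ` unit_circle"
      | i where "i \<in> {1..P}" "x = \<delta> i \<or> x = mirror (\<delta> i)"
      using pairs_exhaustive by blast
    then show ?thesis
    proof cases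
      case 1
      then show ?thesis using mQ[of x] mQ'[of x] by (simp add: is_root_def)
    next
      case 2
      then have "mirror x = x" by (simp only: mirror_fixed_iff)
      then show ?thesis using mQ[of x] mQ'[of x] by simp
    next
      case 3
      then show ?thesis using pair[of i] mQ[of "\<delta> i"] mQ'[of "\<delta> i"] by auto
    qed
  qed
  have "order z Q = order z Q'" for z using same[of "Fin z"] by simp
  moreover have "Q \<noteq> 0" "Q' \<noteq> 0" using Q Q' H_nonzero by (auto simp: spectral_factors_def)
  ultimately obtain c where "Q' = smult c Q" using eq_smult_if_order_eq by blast
  then show ?thesis using that[of c] spectral_factor_smult_iff[OF Q H_nonzero] Q' by blast
qed

lemma profile_eq_iff:
  assumes Q: "Q \<in> spectral_factors D H" and Q': "Q' \<in> spectral_factors D H"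
  shows "profile Q = profile Q' \<longleftrightarrow> (\<exists>\<beta>\<in>unit_circle. Q' = smult \<beta> Q)"
proof
  assume "\<exists>\<beta>\<in>unit_circle. Q' = smult \<beta> Q"
  then obtain \<beta> where \<beta>: "\<beta> \<in> unit_circle" "Q' = smult \<beta> Q" by blast
  then have "\<beta> \<noteq> 0" by (auto simp: unit_circle_def)
  moreover have "root_mult D (smult \<beta> Q) x = root_mult D Q x" if "\<beta> \<noteq> 0" for x
    using that by (cases x) (simp_all add: order_smult)
  ultimately show "profile Q = profile Q'" using \<beta> by (simp add: profile_def)
qed (use profile_determines_factor[OF Q Q'] in blast)

text \<open>
  Starting from any spectral factor, the multiplicities at \<open>\<delta> 1, \<dots>, \<delta> P\<close> can be adjusted in turn,
  because the adjustment at one pair leaves the other pairs alone.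
\<close>

lemma profile_image:
  assumes "spectral_factors D H \<noteq> {}"
  shows "profile ` spectral_factors D H =
    (\<Pi>\<^sub>E i\<in>{1..P}. {0..root_mult (2 * D) H (\<delta> i)})"
proof (intro equalityI subsetI)
  fix n assume "n \<in> profile ` spectral_factors D H"
  then obtain Q where "Q \<in> spectral_factors D H" "n = profile Q" by blast
  then show "n \<in> (\<Pi>\<^sub>E i\<in>{1..P}. {0..root_mult (2 * D) H (\<delta> i)})"
    using root_mult_spectral_factor[OF _ H_nonzero, of Q] by (auto simp: profile_def)
next
  fix n assume n: "n \<in> (\<Pi>\<^sub>E i\<in>{1..P}. {0..root_mult (2 * D) H (\<delta> i)})"
  have "\<exists>Q\<in>spectral_factors D H. \<forall>i\<in>{1..k}. root_mult D Q (\<delta> i) = n i" if "k \<le> P" for k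
    using that
  proof (induction k)
    case 0
    then show ?case using assms by auto
  next
    case (Suc k)
    then obtain Q where Q: "Q \<in> spectral_factors D H" "\<forall>i\<in>{1..k}. root_mult D Q (\<delta> i) = n i"
      by auto
    have k: "Suc k \<in> {1..P}" using Suc.prems by simp
    have "\<delta> (Suc k) \<noteq> mirror (\<delta> (Suc k))"
      using pair_off_circle[OF k] mirror_fixed_iff[of "\<delta> (Suc k)"] by metis
    moreover have "n (Suc k) \<le> root_mult (2 * D) H (\<delta> (Suc k))" using PiE_mem[OF n k] by simp
    ultimately obtain Q' where Q': "Q' \<in> spectral_factors D H"
      "root_mult D Q' (\<delta> (Suc k)) = n (Suc k)"
      "\<And>y. y \<noteq> \<delta> (Suc k) \<Longrightarrow> y \<noteq> mirror (\<delta> (Suc k)) \<Longrightarrow> root_mult D Q' y = root_mult D Q y"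
      using spectral_factor_set_mult[OF Q(1) H_nonzero] by blast
    have "root_mult D Q' (\<delta> i) = n i" if "i \<in> {1..Suc k}" for i
    proof (cases "i = Suc k")
      case False
      then have "i \<in> {1..k}" "i \<in> {1..P}" using that Suc.prems by auto
      then show ?thesis using Q'(3) Q(2) pairs_distinct[OF _ k False] by simp
    qed (simp add: Q')
    then show ?case using Q'(1) by blast
  qed
  then obtain Q where Q: "Q \<in> spectral_factors D H" "\<forall>i\<in>{1..P}. root_mult D Q (\<delta> i) = n i"
    by blast
  then have "profile Q = n"
    using n by (intro ext) (auto simp: profile_def PiE_def extensional_def)
  then show "n \<in> profile ` spectral_factors D H" using Q(1) by blast
qed

text \<open>
  Each simple pair has exactly one of its two points as a root of \<open>Q\<close>, and every root of \<open>Q\<close>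
  arises in this way. Hence there are as many pairs as roots of \<open>Q\<close>, namely \<open>D\<close>.
\<close>

lemma pair_count_if_simple:
  assumes Q: "Q \<in> spectral_factors D H"
    and simple: "\<And>x. is_root (2 * D) H x \<Longrightarrow> root_mult (2 * D) H x = 1 \<and> x \<notin> Fin ` unit_circle"
  shows "P = D"
proof -
  note mQ = root_mult_spectral_factor[OF Q H_nonzero]
  have mH: "root_mult (2 * D) H x \<le> 1" for x
    using simple[of x] by (cases "root_mult (2 * D) H x = 0") (auto simp: is_root_def)
  define g where "g i = (if root_mult D Q (\<delta> i) > 0 then \<delta> i else mirror (\<delta> i))" for i
  have "bij_betw g {1..P} {x. root_mult D Q x > 0}"
  proof (rule bij_betw_imageI)
    show "inj_on g {1..P}"
    proof (rule inj_onI, rule ccontr)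
      fix i j assume ij: "i \<in> {1..P}" "j \<in> {1..P}" "g i = g j" "i \<noteq> j"
      then have "\<delta> i = \<delta> j \<or> \<delta> i = mirror (\<delta> j)"
        unfolding g_def by (metis mirror_mirror)
      then show False using pairs_distinct ij by blast
    qed
    show "g ` {1..P} = {x. root_mult D Q x > 0}"
    proof (intro equalityI subsetI)
      fix x assume "x \<in> g ` {1..P}"
      then obtain i where "i \<in> {1..P}" "x = g i" by blast
      then show "x \<in> {x. root_mult D Q x > 0}"
        using pair_root[of i] mQ[of "\<delta> i"] by (auto simp: g_def is_root_def)
    next
      fix x assume "x \<in> {x. root_mult D Q x > 0}"
      then have pos: "root_mult D Q x > 0" by simp
      then have "is_root (2 * D) H x" using mQ[of x] by (simp add: is_root_def)
      then obtain i where i: "i \<in> {1..P}" "x = \<delta> i \<or> x = mirror (\<delta> i)"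
        using pairs_exhaustive simple by blast
      have "x = g i"
      proof (cases "x = \<delta> i")
        case True
        then show ?thesis using pos by (simp add: g_def)
      next
        case False
        then have "x = mirror (\<delta> i)" using i by blast
        moreover from this have "root_mult D Q (\<delta> i) = 0"
          using mQ[of "\<delta> i"] mH[of "\<delta> i"] pos by simp
        ultimately show ?thesis by (simp add: g_def)
      qed
      then show "x \<in> g ` {1..P}" using i by blast
    qed
  qed
  then have "P = card {x. root_mult D Q x > 0}" by (auto dest: bij_betw_same_card)
  also have "\<dots> = D"
  proof (rule conjunct2[OF card_roots_if_simple])
    show "Q \<in> polys_le D" "Q \<noteq> 0" using Q H_nonzero by (auto simp: spectral_factors_def)
    show "root_mult D Q x \<le> 1" for x using mQ[of x] mH[of x] by simp
  qed
  finally show ?thesis .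
qed

end

section \<open>From tuples to spectral factors\<close>

text \<open>
  The cofactors of the gcd have no common root on the extended plane: if \<open>x\<close> were one, then
  \<open>root_factor x * Q\<close> would be a common divisor in the space of degree bound \<open>D + 1\<close>, contradicting
  maximality. Vanishing cofactors are divisible by everything and have to be left out when
  multiplicities are considered.
\<close>

lemma gcd_cofactors:
  assumes gcd: "is_gcd ((\<lambda>k. (M, X k)) ` I) D Q"
    and nonzero: "\<exists>k\<in>I. X k \<noteq> 0"
  obtains L R where "M = L + D" "Q \<in> polys_le D" "Q \<noteq> 0"
    "\<And>k. k \<in> I \<Longrightarrow> R k \<in> polys_le L" "\<And>k. k \<in> I \<Longrightarrow> X k = R k * Q"
    "\<And>x. \<exists>k\<in>I. R k \<noteq> 0 \<and> root_mult L (R k) x = 0"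
proof -
  define L where "L = M - D"
  have div: "has_divisor M (X k) D Q" if "k \<in> I" for k
    using gcd that by (auto simp: is_gcd_def common_divisor_def)
  then have Q: "Q \<in> polys_le D" "Q \<noteq> 0" and M: "M = L + D"
    using nonzero by (auto simp: has_divisor_def L_def)
  have "\<forall>k\<in>I. \<exists>A. A \<in> polys_le L \<and> X k = A * Q"
    using div by (auto simp: has_divisor_def L_def)
  then obtain R where R: "\<And>k. k \<in> I \<Longrightarrow> R k \<in> polys_le L" "\<And>k. k \<in> I \<Longrightarrow> X k = R k * Q"
    by metis
  have "\<exists>k\<in>I. R k \<noteq> 0 \<and> root_mult L (R k) x = 0" for x
  proof (rule ccontr)
    assume none: "\<not> ?thesis"
    have factor: "\<exists>E B. L = 1 + E \<and> B \<in> polys_le E \<and> R k = root_factor x * B"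
      if "k \<in> I" "R k \<noteq> 0" for k
      using root_factorE[OF R(1)[OF that(1)] that(2), of x] none that by (metis gr0I)
    obtain k0 where "k0 \<in> I" "X k0 \<noteq> 0" using nonzero by blast
    then have "R k0 \<noteq> 0" using R(2) by auto
    then obtain E where E: "L = 1 + E" using factor \<open>k0 \<in> I\<close> by blast
    have "has_divisor M (X k) (1 + D) (root_factor x * Q)" if k: "k \<in> I" for k
    proof -
      have "\<exists>B\<in>polys_le E. R k = root_factor x * B"
      proof (cases "R k = 0")
        case True
        then show ?thesis by (intro bexI[of _ 0]) (auto simp: polys_le_def)
      next
        case False
        then show ?thesis using factor[OF k] E by auto
      qed
      then obtain B where "B \<in> polys_le E" "X k = B * (root_factor x * Q)"
        using R(2)[OF k] by (auto simp: mult_ac)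
      moreover have "M - (1 + D) = E" "1 + D \<le> M" using M E by auto
      ultimately show ?thesis
        using mult_in_polys_le[OF root_factor_in_polys_le Q(1)] Q(2) root_factor_nonzero
        by (auto simp: has_divisor_def)
    qed
    then have "1 + D \<le> D" using gcd by (force simp: is_gcd_def common_divisor_def)
    then show False by simp
  qed
  then show ?thesis using that M Q R by blast
qed

text \<open>
  Comparing the equations with a fixed second index gives \<open>Y\<^sub>i R\<^sub>j = Y\<^sub>j R\<^sub>i\<close>. At each finite point some
  \<open>R\<^sub>j\<close> does not vanish, so every root of \<open>R\<^sub>m\<close> there is a root of \<open>Y\<^sub>m\<close>, and \<open>R\<^sub>m\<close> divides \<open>Y\<^sub>m\<close>. The
  quotient serves for all indices. That infinity is not a common root either supplies an index \<open>m\<close>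
  for which \<open>R\<^sub>m\<close> has degree exactly \<open>L\<close>, and this bounds the degree of the quotient by \<open>D\<close>.
\<close>

lemma solutions_eq_multiples_of_spectral_factors:
  assumes N: "N - 1 = L + D" and Q: "Q \<in> polys_le D" "Q \<noteq> 0"
    and R: "\<And>k. k \<in> {1..K} \<Longrightarrow> R k \<in> polys_le L"
    and no_common_root: "\<And>x. \<exists>k\<in>{1..K}. R k \<noteq> 0 \<and> root_mult L (R k) x = 0"
    and \<Gamma>: "\<And>i j. i \<in> {1..K} \<Longrightarrow> j \<in> {1..K} \<Longrightarrow>
      \<Gamma> i j = (R i * Q) * conj_rev (N - 1) (R j * Q)"
  shows "solutions N K \<Gamma> =
    (\<lambda>Q'. \<lambda>k\<in>{1..K}. R k * Q') ` spectral_factors D (Q * conj_rev D Q)"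
proof -
  let ?H = "Q * conj_rev D Q"
  have corr: "(R i * A) * conj_rev (N - 1) (R j * A) =
      (R i * conj_rev L (R j)) * (A * conj_rev D A)"
    if "A \<in> polys_le D" "j \<in> {1..K}" for A i j
    unfolding N conj_rev_mult[OF R[OF that(2)] that(1)] by (simp add: mult_ac)
  show ?thesis
  proof (intro equalityI subsetI)
    fix Y assume "Y \<in> (\<lambda>Q'. \<lambda>k\<in>{1..K}. R k * Q') ` spectral_factors D ?H"
    then obtain Q' where Q': "Q' \<in> polys_le D" "Q' * conj_rev D Q' = ?H"
      and Y: "Y = (\<lambda>k\<in>{1..K}. R k * Q')"
      by (auto simp: spectral_factors_def)
    have "Y \<in> {1..K} \<rightarrow>\<^sub>E polys_le (N - 1)"
      unfolding Y N using mult_in_polys_le[OF R Q'(1)] by auto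
    moreover have "\<Gamma> i j = Y i * conj_rev (N - 1) (Y j)" if "i \<in> {1..K}" "j \<in> {1..K}" for i j
      using that by (simp add: Y \<Gamma> corr Q Q' del: One_nat_def atLeastAtMost_iff)
    ultimately show "Y \<in> solutions N K \<Gamma>" by (simp add: solutions_def)
  next
    fix Y assume "Y \<in> solutions N K \<Gamma>"
    then have ext: "Y \<in> {1..K} \<rightarrow>\<^sub>E polys_le (N - 1)"
      and Y_eq: "\<And>i j. i \<in> {1..K} \<Longrightarrow> j \<in> {1..K} \<Longrightarrow>
        Y i * conj_rev (N - 1) (Y j) = (R i * Q) * conj_rev (N - 1) (R j * Q)"
      using \<Gamma> unfolding solutions_def by auto
    obtain m where m: "m \<in> {1..K}" "R m \<noteq> 0" "root_mult L (R m) Infty = 0"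
      using no_common_root by blast
    have deg: "degree (R m) = L"
      using root_mult_Infty[OF R[OF m(1)] m(2)] m(3) R[OF m(1)] by (simp add: polys_le_def)
    have Rm: "R m * conj_rev L (R m) \<noteq> 0" using m R[OF m(1)] by (simp add: conj_rev_eq_0_iff)
    have "Y m * conj_rev (N - 1) (Y m) = (R m * conj_rev L (R m)) * ?H"
      using Y_eq[OF m(1) m(1)] corr[OF Q(1) m(1)] by simp
    moreover have "\<dots> \<noteq> 0" using Rm Q by (simp add: conj_rev_eq_0_iff)
    ultimately have Ym: "Y m \<noteq> 0" "conj_rev (N - 1) (Y m) \<noteq> 0" by auto
    have cross: "Y i * R j = Y j * R i" if "i \<in> {1..K}" "j \<in> {1..K}" for i j
    proof -
      have "Y i * R j * conj_rev (N - 1) (Y m) = Y j * R i * conj_rev (N - 1) (Y m)"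
        using Y_eq[OF that(1) m(1)] Y_eq[OF that(2) m(1)] by (simp add: mult_ac)
      then show ?thesis using Ym(2) by simp
    qed
    have "R m dvd Y m"
    proof (rule dvd_if_order_le[OF m(2) Ym(1)])
      fix z
      obtain j where j: "j \<in> {1..K}" "R j \<noteq> 0" "order z (R j) = 0"
        using no_common_root[of "Fin z"] by auto
      \<comment> \<open>Read at \<open>z\<close>, where \<open>R\<^sub>j\<close> does not vanish, the cross relation bounds the order of \<open>R\<^sub>m\<close>.\<close>
      have c: "Y m * R j = Y j * R m" using cross[OF m(1) j(1)] .
      have "order z (Y m) = order z (Y m * R j)" using Ym j by (simp add: order_mult)
      also have "\<dots> = order z (Y j) + order z (R m)"
        unfolding c using c Ym j by (intro order_mult) auto
      finally show "order z (R m) \<le> order z (Y m)" by simp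
    qed
    then obtain Q' where Q': "Y m = R m * Q'" by blast
    have Y: "Y k = R k * Q'" if "k \<in> {1..K}" for k
      using cross[OF that m(1)] m(2) by (simp add: Q' mult_ac)
    have "degree (Y m) \<le> L + D" using PiE_mem[OF ext m(1)] N by (simp add: polys_le_def)
    moreover have "degree (Y m) = L + degree Q'"
      using Ym(1) m(2) deg by (auto simp: Q' degree_mult_eq)
    ultimately have Q'_le: "Q' \<in> polys_le D" by (simp add: polys_le_def)
    have "Q' * conj_rev D Q' = ?H"
    proof -
      have "(R m * conj_rev L (R m)) * (Q' * conj_rev D Q') = (R m * conj_rev L (R m)) * ?H"
        using Y_eq[OF m(1) m(1), unfolded Q'] by (simp only: corr[OF Q(1) m(1)] corr[OF Q'_le m(1)])
      then show ?thesis using Rm by (simp only: mult_cancel_left) blast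
    qed
    moreover have "Y = (\<lambda>k\<in>{1..K}. R k * Q')"
      using Y PiE_arb[OF ext] by (intro HOL.ext) (auto simp del: One_nat_def)
    ultimately show "Y \<in> (\<lambda>Q'. \<lambda>k\<in>{1..K}. R k * Q') ` spectral_factors D ?H"
      using Q'_le by (auto simp: spectral_factors_def)
  qed
qed

lemma card_quotient_eq_card_image:
  assumes E: "E = {(x, y) \<in> S \<times> S. f x = f y}"
  shows "card (S // E) = card (f ` S)"
proof -
  let ?fibre = "\<lambda>b. {y \<in> S. f y = b}"
  have "S // E = ?fibre ` f ` S"
    unfolding quotient_def E by (force simp: image_iff)
  moreover have "inj_on ?fibre (f ` S)" by (rule inj_onI) blast
  ultimately show ?thesis by (simp add: card_image)
qed

theorem corollary31:
  fixes N K D P T :: nat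
    and X :: "nat \<Rightarrow> complex poly"
    and \<Gamma> :: "nat \<Rightarrow> nat \<Rightarrow> complex poly"
    and Q H :: "complex poly"
    and \<delta> :: "nat \<Rightarrow> ext_complex" and \<mu> :: "nat \<Rightarrow> nat"
    and \<epsilon> :: "nat \<Rightarrow> complex" and \<nu> :: "nat \<Rightarrow> nat"
  assumes "N \<ge> 1" and "K \<ge> 1"
    and X_space: "\<And>k. k \<in> {1..K} \<Longrightarrow> X k \<in> polys_le (N - 1)"
    and X_nonzero: "\<exists>k\<in>{1..K}. X k \<noteq> 0"
    and \<Gamma>_eq: "\<And>i j. i \<in> {1..K} \<Longrightarrow> j \<in> {1..K} \<Longrightarrow> \<Gamma> i j = X i * conj_rev (N - 1) (X j)"
    and Q_gcd: "is_gcd ((\<lambda>k. (N - 1, X k)) ` {1..K}) D Q"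
    and H_eq: "H = Q * conj_rev D Q"
    and \<delta>_roots: "\<And>i. i \<in> {1..P} \<Longrightarrow> is_root (2 * D) H (\<delta> i) \<and> \<delta> i \<notin> Fin ` unit_circle"
    and \<delta>_mult: "\<And>i. i \<in> {1..P} \<Longrightarrow> \<mu> i = root_mult (2 * D) H (\<delta> i)"
    and \<delta>_distinct: "\<And>i j. i \<in> {1..P} \<Longrightarrow> j \<in> {1..P} \<Longrightarrow> i \<noteq> j \<Longrightarrow>
          \<delta> i \<noteq> \<delta> j \<and> \<delta> i \<noteq> ext_inverse (ext_cnj (\<delta> j))"
    and \<delta>_all: "\<And>x. is_root (2 * D) H x \<Longrightarrow> x \<notin> Fin ` unit_circle \<Longrightarrow>
          \<exists>i\<in>{1..P}. x = \<delta> i \<or> x = ext_inverse (ext_cnj (\<delta> i))"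
    and \<epsilon>_roots: "\<And>i. i \<in> {1..T} \<Longrightarrow> is_root (2 * D) H (Fin (\<epsilon> i)) \<and> \<epsilon> i \<in> unit_circle"
    and \<epsilon>_mult: "\<And>i. i \<in> {1..T} \<Longrightarrow> \<nu> i = root_mult (2 * D) H (Fin (\<epsilon> i))"
    and \<epsilon>_distinct: "inj_on \<epsilon> {1..T}"
    and \<epsilon>_all: "\<And>z. is_root (2 * D) H (Fin z) \<Longrightarrow> z \<in> unit_circle \<Longrightarrow> z \<in> \<epsilon> ` {1..T}"
  shows "card (solutions N K \<Gamma> // phase_equiv N K \<Gamma>) = (\<Prod>i=1..P. (\<mu> i + 1)) \<and>
    ((\<forall>x. is_root (2 * D) H x \<longrightarrow> root_mult (2 * D) H x = 1 \<and> x \<notin> Fin ` unit_circle) \<longrightarrow>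
       card (solutions N K \<Gamma> // phase_equiv N K \<Gamma>) = 2 ^ D)"
proof -
  obtain L R where N: "N - 1 = L + D" and Q: "Q \<in> polys_le D" "Q \<noteq> 0"
    and R: "\<And>k. k \<in> {1..K} \<Longrightarrow> R k \<in> polys_le L"
    and X: "\<And>k. k \<in> {1..K} \<Longrightarrow> X k = R k * Q"
    and coprime: "\<And>x. \<exists>k\<in>{1..K}. R k \<noteq> 0 \<and> root_mult L (R k) x = 0"
    by (rule gcd_cofactors[OF Q_gcd X_nonzero]) (rule that; assumption)
  let ?S = "solutions N K \<Gamma>" and ?F = "spectral_factors D H"
  define G where "G Q' = (\<lambda>k\<in>{1..K}. R k * Q')" for Q'
  have H: "H \<noteq> 0" using Q by (simp add: H_eq conj_rev_eq_0_iff)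
  then interpret root_pairs D P H \<delta>
    using \<delta>_roots \<delta>_distinct \<delta>_all by unfold_locales blast+
  have S: "?S = G ` ?F"
    unfolding G_def H_eq
  proof (rule solutions_eq_multiples_of_spectral_factors[OF N Q R coprime])
    show "\<Gamma> i j = (R i * Q) * conj_rev (N - 1) (R j * Q)"
      if "i \<in> {1..K}" "j \<in> {1..K}" for i j
      using \<Gamma>_eq[OF that] X[OF that(1)] X[OF that(2)] by simp
  qed
  obtain m where m: "m \<in> {1..K}" "R m \<noteq> 0" using coprime by blast
  have inj: "inj_on G ?F"
  proof (rule inj_onI)
    fix A B assume "G A = G B"
    from fun_cong[OF this, of m] show "A = B" using m by (simp add: G_def)
  qed
  \<comment> \<open>The profile of the spectral factor behind a solution separates the phase classes.\<close>
  define f where "f = profile \<circ> inv_into ?F G"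
  have f: "f (G A) = profile A" if "A \<in> ?F" for A
    using inv_into_f_f[OF inj that] by (simp add: f_def)
  have phase: "(\<forall>k\<in>{1..K}. G B k = smult \<beta> (G A k)) \<longleftrightarrow> B = smult \<beta> A" for A B \<beta>
  proof
    assume "\<forall>k\<in>{1..K}. G B k = smult \<beta> (G A k)"
    then have "R m * B = R m * smult \<beta> A" using m by (simp add: G_def)
    then show "B = smult \<beta> A" using m(2) by (simp only: mult_cancel_left) simp
  qed (simp add: G_def)
  have "phase_equiv N K \<Gamma> = {(Y, Y') \<in> ?S \<times> ?S. f Y = f Y'}"
    unfolding phase_equiv_def S
    by (auto simp: f phase profile_eq_iff simp del: One_nat_def)
  then have "card (?S // phase_equiv N K \<Gamma>) = card (f ` ?S)"
    by (rule card_quotient_eq_card_image)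
  also have "f ` ?S = profile ` ?F"
    unfolding S by (force simp: f image_image)
  also have "card \<dots> = (\<Prod>i=1..P. (\<mu> i + 1))"
  proof -
    have "Q \<in> ?F" using Q by (simp add: spectral_factors_def H_eq)
    then show ?thesis by (subst profile_image) (auto simp: card_PiE \<delta>_mult)
  qed
  finally have count: "card (?S // phase_equiv N K \<Gamma>) = (\<Prod>i=1..P. (\<mu> i + 1))" .
  moreover have "card (?S // phase_equiv N K \<Gamma>) = 2 ^ D"
    if simple: "\<forall>x. is_root (2 * D) H x \<longrightarrow> root_mult (2 * D) H x = 1 \<and> x \<notin> Fin ` unit_circle"
  proof -
    have "Q \<in> ?F" using Q by (simp add: spectral_factors_def H_eq)
    then have "P = D" by (rule pair_count_if_simple) (use simple in blast)
    moreover have "\<mu> i = 1" if "i \<in> {1..P}" for i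
      using that \<delta>_mult \<delta>_roots simple by simp
    then have "(\<Prod>i=1..P. (\<mu> i + 1)) = (\<Prod>i=1..P. 2)" by (intro prod.cong) auto
    ultimately show ?thesis using count by simp
  qed
  ultimately show ?thesis by blast
qed

end
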